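(* For primes $p<q$, the independence polynomial of $\varGamma(\mathbb{Z}_{p^2q})$ is $$I(\varGamma(\mathbb{Z}_{p^2q}),x)=(1+x)^{(p-1)(p+q-1)}+(1+x)^{p(q-1)}-(1+x)^{(p-1)(q-1)}+(p-1)x(1+x)^{p(p-1)}.$$
   Context: For a positive integer $n$, the zero divisor graph $\varGamma(\mathbb{Z}_n)$ is the simple undirected graph whose vertices are the non-zero zero divisors of the ring $\mathbb{Z}_n$ of integers modulo $n$ (non-zero $a$ such that $ab=0$ for some non-zero $b$), two distinct vertices $a,b$ being adjacent if and only if $ab=0$ in $\mathbb{Z}_n$. An independent set of a finite graph $G$ is a set of vertices no two of which are adjacent (the empty set included); $\alpha(G)$ is the maximum size of an independent set, and $s_k(G)$ is the number of independent sets of size $k$. The independence polynomial of $G$ is $I(G,x)=\sum_{k=0}^{\alpha(G)} s_k(G)x^k$. *)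

theory Defs
  imports
    "HOL-Number_Theory.Residues"
    "HOL-Computational_Algebra.Polynomial"
    "Graph_Theory.Pair_Digraph"
begin

definition nonzero_zero_divisors :: "('a, 'm) ring_scheme \<Rightarrow> 'a set" where
  "nonzero_zero_divisors R =
     {a \<in> carrier R. a \<noteq> \<zero>\<^bsub>R\<^esub> \<and> (\<exists>b \<in> carrier R. b \<noteq> \<zero>\<^bsub>R\<^esub> \<and> a \<otimes>\<^bsub>R\<^esub> b = \<zero>\<^bsub>R\<^esub>)}"

text \<open>A simple undirected graph is represented by its symmetric, irreflexive arc relation, the
  locale \<^locale>\<open>pair_graph\<close>.\<close>

definition zero_divisor_graph :: "('a, 'm) ring_scheme \<Rightarrow> 'a pair_pre_digraph" where
  "zero_divisor_graph R =
     \<lparr> pverts = nonzero_zero_divisors R,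
       parcs = {(a, b). a \<in> nonzero_zero_divisors R \<and> b \<in> nonzero_zero_divisors R \<and>
                        a \<noteq> b \<and> a \<otimes>\<^bsub>R\<^esub> b = \<zero>\<^bsub>R\<^esub>} \<rparr>"

text \<open>\<^term>\<open>residue_ring 1\<close> is not a ring in the sense of HOL-Algebra (its unit is outside the
  carrier), but the unit is irrelevant here and the resulting graph is empty, as it should be.\<close>

definition zero_divisor_graph_Zn :: "nat \<Rightarrow> int pair_pre_digraph" where
  "zero_divisor_graph_Zn n = zero_divisor_graph (residue_ring (int n))"

lemma pair_graph_zero_divisor_graph_Zn: "pair_graph (zero_divisor_graph_Zn n)"
proof -
  let ?V = "nonzero_zero_divisors (residue_ring (int n))"
  have V: "finite ?V"
    by (rule finite_subset[of _ "{0..int n - 1}"])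
       (auto simp: nonzero_zero_divisors_def residue_ring_def)
  have E: "finite (parcs (zero_divisor_graph_Zn n))"
    by (rule finite_subset[of _ "?V \<times> ?V"])
       (use V in \<open>auto simp: zero_divisor_graph_Zn_def zero_divisor_graph_def\<close>)
  show ?thesis
    by unfold_locales
       (use V E in \<open>auto simp: zero_divisor_graph_Zn_def zero_divisor_graph_def
          residue_ring_def symmetric_def mult.commute intro!: symI\<close>)
qed

definition independent_set :: "'a pair_pre_digraph \<Rightarrow> 'a set \<Rightarrow> bool" where
  "independent_set G S \<longleftrightarrow>
     S \<subseteq> pverts G \<and> (\<forall>a \<in> S. \<forall>b \<in> S. a \<noteq> b \<longrightarrow> (a, b) \<notin> parcs G)"

definition independence_number :: "'a pair_pre_digraph \<Rightarrow> nat" where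
  "independence_number G = Max {card S | S. independent_set G S}"

definition num_independent_sets :: "'a pair_pre_digraph \<Rightarrow> nat \<Rightarrow> nat" where
  "num_independent_sets G k = card {S. independent_set G S \<and> card S = k}"

definition independence_poly :: "'a pair_pre_digraph \<Rightarrow> int poly" where
  "independence_poly G =
     (\<Sum>k = 0..independence_number G. monom (int (num_independent_sets G k)) k)"

end

theory Submission
  imports Defs
begin

text \<open>The nonzero zero divisors of \<open>\<int>\<^sub>n\<close>, \<open>n = p\<^sup>2 q\<close>, fall into the four classes of elements
  whose greatest common divisor with \<open>n\<close> is \<open>p\<close>, \<open>p\<^sup>2\<close>, \<open>q\<close> or \<open>pq\<close>. Adjacency only depends on the
  classes: \<open>pq\<close> is a clique joined to \<open>p\<close> and \<open>p\<^sup>2\<close>, the class \<open>p\<^sup>2\<close> is joined to \<open>q\<close>, and there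
  are no other edges. So an independent set without elements of class \<open>pq\<close> is a subset of
  \<open>p \<union> q\<close> or of \<open>p \<union> p\<^sup>2\<close> (inclusion-exclusion gives the first three terms), and any other one
  consists of one element of class \<open>pq\<close> and a set of elements of class \<open>q\<close>.\<close>

text \<open>Each element of \<open>A\<close> is either left out (factor 1) or taken (factor
  \<open>x\<close>), so a full power set contributes a single power of \<open>1 + x\<close>.\<close>

lemma sum_Pow_power_card:
  fixes x :: "'a :: comm_semiring_1"
  assumes "finite A"
  shows "(\<Sum>S\<in>Pow A. x ^ card S) = (1 + x) ^ card A"
  using assms
proof induction
  case (insert a A)
  have "(\<Sum>S\<in>Pow (insert a A). x ^ card S)
      = (\<Sum>S\<in>Pow A. x ^ card S) + (\<Sum>S\<in>insert a ` Pow A. x ^ card S)"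
    unfolding Pow_insert using insert.hyps by (intro sum.union_disjoint) auto
  also have "(\<Sum>S\<in>insert a ` Pow A. x ^ card S) = (\<Sum>S\<in>Pow A. x ^ card (insert a S))"
    using insert.hyps by (intro sum.reindex_cong[where l = "insert a"]) (auto simp: inj_on_def)
  also have "\<dots> = (\<Sum>S\<in>Pow A. x * x ^ card S)"
  proof (intro sum.cong refl)
    fix S assume "S \<in> Pow A"
    then have "finite S" "a \<notin> S" using insert.hyps finite_subset by auto
    then show "x ^ card (insert a S) = x * x ^ card S" by simp
  qed
  finally show ?case
    using insert by (simp add: sum_distrib_left[symmetric] algebra_simps)
qed simp

text \<open>Grouping independent sets by size replaces the coefficients by a sum over the sets
  themselves, so that splitting the family of independent sets splits the polynomial.\<close>

lemma independence_poly_conv_sum: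
  assumes "finite (pverts G)"
  shows "independence_poly G = (\<Sum>S | independent_set G S. [:0, 1:] ^ card S)"
proof -
  let ?I = "{S. independent_set G S}"
  have fin: "finite ?I"
    by (rule finite_subset[of _ "Pow (pverts G)"]) (use assms in \<open>auto simp: independent_set_def\<close>)
  have card_le: "card ` ?I \<subseteq> {0..independence_number G}"
    using fin by (auto simp: independence_number_def setcompr_eq_image intro!: Max_ge)
  have "(\<Sum>S\<in>?I. [:0, 1:] ^ card S)
      = (\<Sum>k\<in>{0..independence_number G}. \<Sum>S\<in>{S \<in> ?I. card S = k}. [:0, 1:] ^ card S :: int poly)"
    using fin card_le by (intro sum.group[symmetric]) auto
  also have "\<dots> = independence_poly G"
    unfolding independence_poly_def num_independent_sets_def
    by (intro sum.cong) (auto simp: monom_altdef of_nat_poly)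
  finally show ?thesis ..
qed

text \<open>\<open>P\<close>, \<open>T\<close>, \<open>Q\<close>, \<open>Z\<close> stand for the
  classes with gcd p, p^2, q, pq.\<close>

lemma independence_poly_four_classes:
  assumes verts: "pverts G = P \<union> T \<union> Q \<union> Z" and fin: "finite (pverts G)"
    and disj: "P \<inter> T = {}" "P \<inter> Q = {}" "P \<inter> Z = {}" "T \<inter> Q = {}" "T \<inter> Z = {}" "Q \<inter> Z = {}"
    and arcs: "\<And>a b. (a, b) \<in> parcs G \<longleftrightarrow> a \<noteq> b \<and>
        (a \<in> Z \<and> b \<in> Z \<or> a \<in> Z \<and> b \<in> P \<union> T \<or> a \<in> P \<union> T \<and> b \<in> Z \<or> a \<in> T \<and> b \<in> Q \<or> a \<in> Q \<and> b \<in> T)"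
  shows "independence_poly G =
    (1 + [:0, 1:]) ^ (card P + card Q) + (1 + [:0, 1:]) ^ (card P + card T) - (1 + [:0, 1:]) ^ card P
    + of_nat (card Z) * [:0, 1:] * (1 + [:0, 1:]) ^ card Q"
proof -
  let ?X = "[:0, 1:] :: int poly"
  let ?w = "\<lambda>S. ?X ^ card S"
  let ?I = "{S. independent_set G S}"
  let ?f = "\<lambda>(z, S). insert z S"
  have fins: "finite P" "finite T" "finite Q" "finite Z"
    using fin by (auto simp: verts)
  have "?I = Pow (P \<union> Q) \<union> Pow (P \<union> T) \<union> ?f ` (Z \<times> Pow Q)" (is "_ = ?R")
  proof (intro equalityI subsetI)
    fix S assume "S \<in> ?I"
    \<comment> \<open>By \<open>arcs\<close> there are no loops, so \<open>ind\<close> also covers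
      \<open>a = b\<close>.\<close>
    then have sub: "S \<subseteq> P \<union> T \<union> Q \<union> Z"
      and ind: "\<And>a b. a \<in> S \<Longrightarrow> b \<in> S \<Longrightarrow> (a, b) \<notin> parcs G"
      using arcs unfolding independent_set_def verts by blast+
    show "S \<in> ?R"
    proof (cases "S \<inter> Z = {}")
      case True
      have "S \<subseteq> P \<union> Q \<or> S \<subseteq> P \<union> T"
      proof (cases "S \<inter> T = {}")
        case True
        then show ?thesis using sub \<open>S \<inter> Z = {}\<close> by blast
      next
        case False
        then obtain t where t: "t \<in> S" "t \<in> T" by blast
        have "y \<notin> Q" if "y \<in> S" for y
          using t that ind[of t y] disj(4) by (auto simp: arcs)
        then show ?thesis using sub \<open>S \<inter> Z = {}\<close> by blast
      qed
      then show ?thesis by blast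
    next
      case False
      then obtain z where z: "z \<in> S" "z \<in> Z" by blast
      \<comment> \<open>\<open>z\<close> is adjacent to every other vertex outside
        \<open>Q\<close>.\<close>
      have "y \<in> Q" if "y \<in> S - {z}" for y
        using z that ind[of z y] sub by (auto simp: arcs)
      then have "(z, S - {z}) \<in> Z \<times> Pow Q" using z by blast
      moreover have "S = ?f (z, S - {z})" using z by auto
      ultimately show ?thesis by (intro UnI2 image_eqI)
    qed
  next
    fix S assume "S \<in> ?R"
    then consider "S \<subseteq> P \<union> Q" | "S \<subseteq> P \<union> T" | z S' where "S = insert z S'" "z \<in> Z" "S' \<subseteq> Q"
      by (elim UnE imageE) auto
    then have "S \<subseteq> pverts G \<and> (\<forall>a\<in>S. \<forall>b\<in>S. (a, b) \<notin> parcs G)"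
    proof cases
      case 1
      then have "y \<notin> T" "y \<notin> Z" if "y \<in> S" for y using that disj by blast+
      then show ?thesis using 1 by (auto simp: verts arcs)
    next
      case 2
      then have "y \<notin> Q" "y \<notin> Z" if "y \<in> S" for y using that disj by blast+
      then show ?thesis using 2 by (auto simp: verts arcs)
    next
      case 3
      then have "y \<in> Z \<longleftrightarrow> y = z" "y \<notin> P" "y \<notin> T" if "y \<in> S" for y
        using that disj by blast+
      then show ?thesis using 3 by (auto simp: verts arcs)
    qed
    then show "S \<in> ?I" by (simp add: independent_set_def)
  qed
  then have "independence_poly G = sum ?w (Pow (P \<union> Q) \<union> Pow (P \<union> T) \<union> ?f ` (Z \<times> Pow Q))"
    by (simp add: independence_poly_conv_sum[OF fin])
  \<comment> \<open>Sets in the image meet \<open>Z\<close>, while those in the two power sets avoid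
    it.\<close>
  also have "\<dots> = sum ?w (Pow (P \<union> Q) \<union> Pow (P \<union> T)) + sum ?w (?f ` (Z \<times> Pow Q))"
    using fins disj by (intro sum.union_disjoint) auto
  also have "sum ?w (Pow (P \<union> Q) \<union> Pow (P \<union> T))
      = sum ?w (Pow (P \<union> Q)) + sum ?w (Pow (P \<union> T)) - sum ?w (Pow (P \<union> Q) \<inter> Pow (P \<union> T))"
    using fins by (intro sum_Un) auto
  also have "Pow (P \<union> Q) \<inter> Pow (P \<union> T) = Pow P"
    using disj by blast
  also have "sum ?w (?f ` (Z \<times> Pow Q)) = (\<Sum>(z, S)\<in>Z \<times> Pow Q. ?X * ?w S)"
  proof (rule sum.reindex_cong)
    \<comment> \<open>\<open>z\<close> is recovered as the only element of \<open>insert z S\<close>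
      in \<open>Z\<close>, because \<open>Q\<close> and \<open>Z\<close> are disjoint.\<close>
    show "inj_on ?f (Z \<times> Pow Q)"
    proof (rule inj_onI, clarsimp)
      fix z S z' S' assume "z \<in> Z" "S \<subseteq> Q" "z' \<in> Z" "S' \<subseteq> Q" and eq: "insert z S = insert z' S'"
      then have "z = z'" "z \<notin> S" "z \<notin> S'" using disj(6) by blast+
      with eq show "z = z' \<and> S = S'" by (simp add: insert_ident)
    qed
    fix y assume "y \<in> Z \<times> Pow Q"
    then obtain z S where y: "y = (z, S)" "z \<in> Z" "S \<subseteq> Q" by auto
    then have "z \<notin> S" "finite S" using disj(6) fins finite_subset by auto
    then show "?w (?f y) = (case y of (z, S) \<Rightarrow> ?X * ?w S)" using y(1) by simp
  qed simp
  also have "\<dots> = of_nat (card Z) * ?X * sum ?w (Pow Q)"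
    by (simp add: sum.cartesian_product[symmetric] sum_distrib_left[symmetric] mult.assoc
        del: mult_pCons_left)
  finally show ?thesis
    using fins disj by (simp add: sum_Pow_power_card card_Un_disjoint del: mult_pCons_left mult_pCons_right)
qed

text \<open>The multiples are \<open>d * k\<close> with \<open>0 < k < m\<close>; the
  \<open>- 1\<close> comes from excluding 0.\<close>

lemma card_multiples:
  fixes d :: int and m :: nat
  assumes "d > 0"
  shows "card {a \<in> {0<..<d * int m}. d dvd a} = m - 1"
proof -
  have "{a \<in> {0<..<d * int m}. d dvd a} = (*) d ` {0<..<int m}"
    using assms by (auto simp: zero_less_mult_iff elim!: dvdE)
  moreover have "inj_on ((*) d) {0<..<int m}"
    using assms by (auto simp: inj_on_def)
  ultimately show ?thesis by (simp add: card_image)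
qed

text \<open>A factor not divisible by \<open>p\<close> is coprime to \<open>p\<^sup>2\<close>, so
  the other factor absorbs all of \<open>p\<^sup>2\<close>.\<close>

lemma prime_square_dvd_mult_iff:
  fixes p :: int
  assumes "prime p"
  shows "p\<^sup>2 dvd a * b \<longleftrightarrow> p\<^sup>2 dvd a \<or> p\<^sup>2 dvd b \<or> p dvd a \<and> p dvd b"
proof
  assume *: "p\<^sup>2 dvd a * b"
  have "coprime (p\<^sup>2) x" if "\<not> p dvd x" for x
    using prime_imp_coprime[OF assms that] by simp
  then show "p\<^sup>2 dvd a \<or> p\<^sup>2 dvd b \<or> p dvd a \<and> p dvd b"
    using * by (metis coprime_dvd_mult_left_iff coprime_dvd_mult_right_iff)
qed (auto simp: power2_eq_square mult_dvd_mono)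

text \<open>The classes with gcd p, p^2, q, pq have (p-1)(q-1), q-1, p(p-1) and p-1
  elements.\<close>

lemma independence_poly_zero_divisor_graph_p2q:
  fixes p q :: nat
  assumes pq: "prime p" "prime q" "p \<noteq> q"
  shows "independence_poly (zero_divisor_graph_Zn (p\<^sup>2 * q)) =
           (1 + [:0, 1:]) ^ ((p - 1) * (p + q - 1)) + (1 + [:0, 1:]) ^ (p * (q - 1))
           - (1 + [:0, 1:]) ^ ((p - 1) * (q - 1))
           + of_nat (p - 1) * [:0, 1:] * (1 + [:0, 1:]) ^ (p * (p - 1))"
proof -
  \<comment> \<open>\<open>P\<close> and \<open>Q\<close> are now the primes as integers, the
    element type of \<open>residue_ring\<close>, not vertex classes.\<close>
  define P Q N where "P = int p" "Q = int q" "N = P\<^sup>2 * Q"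
  have prime: "prime P" "prime Q" and ne: "P \<noteq> Q" and gt: "P > 1" "Q > 1"
    using pq prime_gt_1_nat by (auto simp: P_Q_N_def)
  have cop: "coprime P Q" "coprime (P\<^sup>2) Q"
    using prime ne by (simp_all add: primes_coprime)
  have N_dvd: "N dvd a \<longleftrightarrow> P\<^sup>2 dvd a \<and> Q dvd a" for a
    unfolding P_Q_N_def(3) using cop(2) by (auto intro: divides_mult dvd_mult_left dvd_mult_right)
  have PQ_dvd: "P * Q dvd a \<longleftrightarrow> P dvd a \<and> Q dvd a" for a
    using cop(1) by (auto intro: divides_mult dvd_mult_left dvd_mult_right)
  have sq_dvd: "P dvd a" if "P\<^sup>2 dvd a" for a
    using that by (auto simp: power2_eq_square dvd_mult_left)
  \<comment> \<open>Adjacency becomes a propositional condition on divisibility of each factor by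
    \<open>P\<close>, \<open>P\<^sup>2\<close> and \<open>Q\<close>.\<close>
  have N_dvd_mult: "N dvd a * b \<longleftrightarrow>
      (P\<^sup>2 dvd a \<or> P\<^sup>2 dvd b \<or> P dvd a \<and> P dvd b) \<and> (Q dvd a \<or> Q dvd b)" for a b
    using prime by (simp add: N_dvd prime_square_dvd_mult_iff prime_dvd_mult_iff)
  have not_N_dvd: "\<not> (P\<^sup>2 dvd a \<and> Q dvd a)" if "a \<in> {0<..<N}" for a
    using that zdvd_not_zless[of a N] by (auto simp: N_dvd)

  let ?G = "zero_divisor_graph_Zn (p\<^sup>2 * q)"
  let ?V = "{a \<in> {0<..<N}. P dvd a \<or> Q dvd a}"
  \<comment> \<open>These are the annihilating witnesses: \<open>P * Q\<close> for multiples of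
    \<open>P\<close>, and \<open>P\<^sup>2\<close> for multiples of \<open>Q\<close>.\<close>
  have cofactors: "P * Q \<in> {0<..<N}" "P\<^sup>2 \<in> {0<..<N}"
    using gt by (auto simp: P_Q_N_def(3) power2_eq_square)
  have nzd: "nonzero_zero_divisors (residue_ring N) = ?V" (is "?L = _")
  proof (intro equalityI subsetI)
    fix a assume "a \<in> ?L"
    then obtain b where "a \<in> {0<..<N}" "b \<in> {0<..<N}" "N dvd a * b"
      by (force simp: nonzero_zero_divisors_def residue_ring_def)
    \<comment> \<open>If neither prime divided \<open>a\<close>, all of \<open>N\<close> would
      divide \<open>b\<close>.\<close>
    then show "a \<in> ?V" using not_N_dvd[of b] sq_dvd by (auto simp: N_dvd_mult)
  next
    fix a assume a: "a \<in> ?V"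
    have "N dvd a * (P * Q) \<or> N dvd a * P\<^sup>2"
      using a by (auto simp: N_dvd_mult)
    then obtain b where "b \<in> {0<..<N}" "N dvd a * b" using cofactors by blast
    then show "a \<in> ?L" using a
      by (auto simp: nonzero_zero_divisors_def residue_ring_def intro!: bexI[of _ b])
  qed
  have N_eq: "int (p\<^sup>2 * q) = N" by (simp add: P_Q_N_def)
  have verts: "pverts ?G = ?V"
    by (simp add: zero_divisor_graph_Zn_def zero_divisor_graph_def N_eq nzd del: of_nat_mult of_nat_power)
  have arcs: "(a, b) \<in> parcs ?G \<longleftrightarrow> a \<in> ?V \<and> b \<in> ?V \<and> a \<noteq> b \<and> N dvd a * b" for a b
    by (simp add: zero_divisor_graph_Zn_def zero_divisor_graph_def N_eq nzd del: of_nat_mult of_nat_power)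
       (auto simp: residue_ring_def)

  define M where "M d = {a \<in> {0<..<N}. d dvd a}" for d
  have fin: "finite (M d)" for d
    by (rule finite_subset[of _ "{0<..<N}"]) (auto simp: M_def)
  have card_M: "card (M (P\<^sup>2)) = q - 1" "card (M (P * Q)) = p - 1"
    "card (M P) = p * q - 1" "card (M Q) = p * p - 1"
    using card_multiples[of "P\<^sup>2" q] card_multiples[of "P * Q" p]
      card_multiples[of P "p * q"] card_multiples[of Q "p * p"] gt
    by (simp_all add: M_def P_Q_N_def power2_eq_square mult_ac)
  have M_subs: "M (P\<^sup>2) \<union> M (P * Q) \<subseteq> M P" "M (P * Q) \<subseteq> M Q"
    using sq_dvd by (auto simp: M_def PQ_dvd)
  have M_disj: "M (P\<^sup>2) \<inter> M (P * Q) = {}"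
    using not_N_dvd by (auto simp: M_def PQ_dvd)
  have gt_nat: "p \<ge> 1" "q \<ge> 1" using pq prime_ge_1_nat by auto
  \<comment> \<open>\<open>?A\<close> and \<open>?B\<close> collect the residues with gcd exactly
    \<open>P\<close> and exactly \<open>Q\<close>. \<open>M (P\<^sup>2)\<close> and
    \<open>M (P * Q)\<close> are already exact, since a larger gcd would be \<open>N\<close>
    itself.\<close>
  let ?A = "M P - (M (P\<^sup>2) \<union> M (P * Q))" and ?B = "M Q - M (P * Q)"
  have "card ?A = p * q - 1 - ((q - 1) + (p - 1))"
    using M_subs M_disj fin by (simp add: card_Diff_subset card_Un_disjoint card_M)
  \<comment> \<open>Writing \<open>p\<close> and \<open>q\<close> as successors resolves the
    truncated subtractions.\<close>
  also have "\<dots> = (p - 1) * (q - 1)"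
    using gt_nat by (cases p; cases q) simp_all
  finally have card_A: "card ?A = (p - 1) * (q - 1)" .
  have card_B: "card ?B = p * (p - 1)"
    using M_subs fin gt_nat by (simp add: card_Diff_subset card_M algebra_simps)

  have "independence_poly ?G =
      (1 + [:0, 1:]) ^ (card ?A + card ?B) + (1 + [:0, 1:]) ^ (card ?A + card (M (P\<^sup>2)))
      - (1 + [:0, 1:]) ^ card ?A + of_nat (card (M (P * Q))) * [:0, 1:] * (1 + [:0, 1:]) ^ card ?B"
  proof (rule independence_poly_four_classes)
    show "pverts ?G = ?A \<union> M (P\<^sup>2) \<union> ?B \<union> M (P * Q)"
      unfolding verts M_def PQ_dvd using sq_dvd by blast
    show "finite (pverts ?G)"
      unfolding verts by (rule finite_subset[of _ "{0<..<N}"]) auto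
    show "M (P\<^sup>2) \<inter> ?B = {}" "?A \<inter> ?B = {}"
      using sq_dvd not_N_dvd by (auto simp: M_def PQ_dvd)
    fix a b
    show "(a, b) \<in> parcs ?G \<longleftrightarrow> a \<noteq> b \<and>
        (a \<in> M (P * Q) \<and> b \<in> M (P * Q) \<or> a \<in> M (P * Q) \<and> b \<in> ?A \<union> M (P\<^sup>2) \<or>
         a \<in> ?A \<union> M (P\<^sup>2) \<and> b \<in> M (P * Q) \<or> a \<in> M (P\<^sup>2) \<and> b \<in> ?B \<or> a \<in> ?B \<and> b \<in> M (P\<^sup>2))"
      \<comment> \<open>Only divisibility facts remain; the case check uses that
        \<open>P\<^sup>2\<close> and \<open>Q\<close> never both divide a residue in range.\<close>
      unfolding arcs N_dvd_mult M_def PQ_dvd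
      using not_N_dvd[of a] not_N_dvd[of b] sq_dvd[of a] sq_dvd[of b] by auto
  qed (use M_disj in auto)
  moreover have "card ?A + card ?B = (p - 1) * (p + q - 1)"
    unfolding card_A card_B using gt_nat by (cases p; cases q) (simp_all add: algebra_simps)
  moreover have "card ?A + card (M (P\<^sup>2)) = p * (q - 1)"
    unfolding card_A card_M using gt_nat by (cases p) simp_all
  ultimately show ?thesis
    by (simp only: card_A card_B card_M)
qed

theorem theorem3p1:
  fixes p q :: nat
  assumes "prime p" and "prime q" and "p < q"
  shows "independence_poly (zero_divisor_graph_Zn (p\<^sup>2 * q)) =
           (1 + [:0, 1:]) ^ ((p - 1) * (p + q - 1)) + (1 + [:0, 1:]) ^ (p * (q - 1))
           - (1 + [:0, 1:]) ^ ((p - 1) * (q - 1))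
           + of_nat (p - 1) * [:0, 1:] * (1 + [:0, 1:]) ^ (p * (p - 1))"
  using assms by (intro independence_poly_zero_divisor_graph_p2q) auto

end
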